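(* Let $f:\mathbb{R}\to\mathbb{R}$ be a continuous function. Then $f$ is vertically rigid if and only if there exist $a,b,k\in\mathbb{R}$ such that either $f(x)=a+bx$ for all $x\in\mathbb{R}$, or $f(x)=a+be^{kx}$ for all $x\in\mathbb{R}$.
   Context: For a function $h:\mathbb{R}\to\mathbb{R}$, $\mathrm{graph}(h)=\{(x,h(x)):x\in\mathbb{R}\}\subset\mathbb{R}^2$. A function $f:\mathbb{R}\to\mathbb{R}$ is called vertically rigid if for every $c\in(0,\infty)$, $\mathrm{graph}(cf)$ is isometric to $\mathrm{graph}(f)$, i.e. there exists an isometry $\varphi$ of the Euclidean plane $\mathbb{R}^2$ with $\varphi(\mathrm{graph}(cf))=\mathrm{graph}(f)$. *)

theory Defs
  imports "HOL-Analysis.Analysis"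
begin

text \<open>
  The Euclidean plane is the type \<^typ>\<open>real \<times> real\<close>: the library metric on a product of metric
  spaces is the Euclidean one (\<open>dist_prod_def\<close>), not the maximum metric.
  The name \<open>graph\<close> is already taken by \<open>Map.graph\<close>, which concerns partial functions.
\<close>

definition fun_graph :: "(real \<Rightarrow> real) \<Rightarrow> (real \<times> real) set" where
  "fun_graph h = {(x, h x) |x. x \<in> UNIV}"

definition plane_isometry :: "(real \<times> real \<Rightarrow> real \<times> real) \<Rightarrow> bool" where
  "plane_isometry \<phi> \<longleftrightarrow> bij \<phi> \<and> (\<forall>p q. dist (\<phi> p) (\<phi> q) = dist p q)"

definition isometric_sets :: "(real \<times> real) set \<Rightarrow> (real \<times> real) set \<Rightarrow> bool" where
  "isometric_sets A B \<longleftrightarrow> (\<exists>\<phi>. plane_isometry \<phi> \<and> \<phi> ` A = B)"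

definition vertically_rigid :: "(real \<Rightarrow> real) \<Rightarrow> bool" where
  "vertically_rigid f \<longleftrightarrow> (\<forall>c>0. isometric_sets (fun_graph (\<lambda>x. c * f x)) (fun_graph f))"

end

theory Submission
  imports Defs
begin

text \<open>
  The slopes of the chords of a continuous \<open>f\<close> form an interval \<open>S\<close>, and the chords of \<open>c f\<close>
  have the slopes \<open>c S\<close>. An isometry between the two graphs matches the chord directions, so
  the arcs of directions with slopes in \<open>S\<close> and in \<open>c S\<close> are congruent. If \<open>S\<close> is bounded,
  the second arc shrinks to a point as \<open>c\<close> tends to 0, hence \<open>S\<close> is a point and \<open>f\<close> is affine.
  Otherwise comparing the end points of the arcs shows that, for \<open>c \<noteq> 1\<close>, the linear part of the
  isometry permutes the two coordinate axes. Composing such symmetries yields a law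
  \<open>f (x + u) = c f x + v\<close> for every \<open>c > 0\<close>. The \<open>u\<close> for which a law of this kind holds form a
  closed uncountable subgroup of the reals, that is, all of them; then the factor is
  \<open>exp (k u)\<close>, and the symmetry of \<open>f (x + u)\<close> in \<open>x\<close> and \<open>u\<close> determines \<open>f\<close>.
\<close>

section \<open>Closed and uncountable subgroups of the reals; exponential laws\<close>

text \<open>The integer multiples of a positive element below \<open>e\<close> come within
  \<open>e\<close> of every real, so \<open>S\<close> is dense.\<close>

lemma closed_subgroup_real_eq_UNIV:
  fixes S :: "real set"
  assumes "closed S"
    and diff: "\<And>x y. x \<in> S \<Longrightarrow> y \<in> S \<Longrightarrow> x - y \<in> S"
    and small: "\<And>e. e > 0 \<Longrightarrow> \<exists>u\<in>S. 0 < u \<and> u < e"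
  shows "S = UNIV"
proof -
  have zero: "0 \<in> S"
    using small[of 1] diff by force
  have add: "x + y \<in> S" if "x \<in> S" "y \<in> S" for x y
    using diff[OF that(1) diff[OF zero that(2)]] by simp
  have nat_mult: "of_nat n * u \<in> S" if "u \<in> S" for n :: nat and u
    by (induction n) (use zero add that in \<open>auto simp: algebra_simps\<close>)
  have int_mult: "of_int n * u \<in> S" if "u \<in> S" for n :: int and u
  proof (cases n rule: int_cases2)
    case (nonneg m)
    then show ?thesis using nat_mult[OF that, of m] by simp
  next
    case (nonpos m)
    then show ?thesis using diff[OF zero nat_mult[OF that, of m]] by simp
  qed
  have "x \<in> closure S" for x
    unfolding closure_approachable
  proof (intro allI impI)
    fix e :: real
    assume "e > 0"
    then obtain u where u: "u \<in> S" "0 < u" "u < e"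
      using small by blast
    let ?n = "\<lfloor>x / u\<rfloor>"
    have "of_int ?n * u \<le> x" "x < (of_int ?n + 1) * u"
      using u of_int_floor_le[of "x / u"] real_of_int_floor_add_one_gt[of "x / u"]
      by (simp_all add: pos_le_divide_eq pos_divide_less_eq
          del: of_int_floor_le real_of_int_floor_add_one_gt)
    then have "dist (of_int ?n * u) x < e"
      using u by (simp add: dist_real_def algebra_simps)
    then show "\<exists>y\<in>S. dist y x < e"
      using int_mult[OF u(1)] by blast
  qed
  then show ?thesis
    using \<open>closed S\<close> by auto
qed

text \<open>Otherwise distinct elements are at least \<open>e\<close> apart, and taking the floor of
  \<open>x / e\<close> injects \<open>S\<close> into the integers.\<close>

lemma uncountable_subgroup_real_small:
  fixes S :: "real set"
  assumes "uncountable S"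
    and diff: "\<And>x y. x \<in> S \<Longrightarrow> y \<in> S \<Longrightarrow> x - y \<in> S"
    and "e > 0"
  shows "\<exists>u\<in>S. 0 < u \<and> u < e"
proof (rule ccontr)
  assume none: "\<not> ?thesis"
  have "inj_on (\<lambda>x. \<lfloor>x / e\<rfloor>) S"
  proof (rule inj_onI)
    fix x y
    assume xy: "x \<in> S" "y \<in> S" "\<lfloor>x / e\<rfloor> = \<lfloor>y / e\<rfloor>"
    then have "\<bar>x / e - y / e\<bar> < 1"
      by linarith
    moreover have "\<bar>x / e - y / e\<bar> = \<bar>x - y\<bar> / e"
      using \<open>e > 0\<close> by (simp flip: diff_divide_distrib)
    ultimately have "\<bar>x - y\<bar> / e < 1"
      by (simp only:)
    then have "\<bar>x - y\<bar> < e"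
      using \<open>e > 0\<close> by (simp only: pos_divide_less_eq mult_1)
    then have "x - y < e" "y - x < e"
      by auto
    then have "\<not> 0 < x - y" "\<not> 0 < y - x"
      using none diff[OF xy(1,2)] diff[OF xy(2,1)] by blast+
    then show "x = y" by simp
  qed
  then have "countable S"
    by (rule countableI')
  with assms show False by simp
qed

text \<open>The points where \<open>C\<close> agrees with the exponential form a closed subgroup. It
  contains 1 by the choice of \<open>k\<close>, and it is stable under halving because positive
  square roots are unique, so it has arbitrarily small positive elements.\<close>

lemma continuous_multiplicative_imp_exp:
  fixes C :: "real \<Rightarrow> real"
  assumes cont: "continuous_on UNIV C"
    and mult: "\<And>x y. C (x + y) = C x * C y"
    and pos: "\<And>x. C x > 0"
  shows "\<exists>k. \<forall>x. C x = exp (k * x)"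
proof -
  define k where "k = ln (C 1)"
  let ?S = "{x. C x = exp (k * x)}"
  have half: "x / 2 \<in> ?S" if "x \<in> ?S" for x
  proof -
    have "(C (x / 2))\<^sup>2 = (exp (k * (x / 2)))\<^sup>2"
      using that mult[of "x / 2" "x / 2"] by (simp add: power2_eq_square flip: exp_add)
    then show ?thesis
      using pos[of "x / 2"] by (simp add: power2_eq_iff_nonneg less_imp_le)
  qed
  have pow: "1 / 2 ^ n \<in> ?S" for n
  proof (induction n)
    case 0
    show ?case using pos[of 1] by (simp add: k_def)
  next
    case (Suc n)
    then show ?case using half[OF Suc] by (simp add: field_simps)
  qed
  have "?S = UNIV"
  proof (rule closed_subgroup_real_eq_UNIV)
    show "closed ?S"
      by (intro closed_Collect_eq continuous_intros cont)
    show "x - y \<in> ?S" if "x \<in> ?S" "y \<in> ?S" for x y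
      using that mult[of "x - y" y] by (simp add: exp_diff right_diff_distrib field_simps)
    show "\<exists>u\<in>?S. 0 < u \<and> u < e" if "e > 0" for e
    proof -
      obtain n where "(1 / 2) ^ n < e"
        using real_arch_pow_inv[of e "1/2"] \<open>e > 0\<close> by auto
      then show ?thesis
        using pow[of n] by (intro bexI[of _ "1 / 2 ^ n"]) (auto simp: power_one_over)
    qed
  qed
  then show ?thesis by blast
qed

lemma translation_law_imp_exp:
  fixes f :: "real \<Rightarrow> real"
  assumes cont: "continuous_on UNIV f"
    and law: "\<And>c. c > 0 \<Longrightarrow> \<exists>u v. \<forall>x. f (x + u) = c * f x + v"
    and nonconst: "f x1 \<noteq> f x0"
  shows "\<exists>a b k. \<forall>x. f x = a + b * exp (k * x)"
proof -
  \<comment> \<open>Two points with different values of \<open>f\<close> determine the only possible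
    factor and constant of a law for \<open>u\<close>. Both are continuous in \<open>u\<close> and
    defined even where no law holds, which makes \<open>?S\<close> closed.\<close>
  define C where "C u = (f (x1 + u) - f (x0 + u)) / (f x1 - f x0)" for u
  define V where "V u = f (x0 + u) - C u * f x0" for u
  let ?S = "{u. \<forall>x. f (x + u) = C u * f x + V u}"
  have [continuous_intros]: "continuous_on A (\<lambda>x. f (g x))" if "continuous_on A g" for A g
    using continuous_on_compose2[OF cont that] by auto
  have C_eq: "c = C u \<and> v = V u" if "\<And>x. f (x + u) = c * f x + v" for c u v
    using that[of x0] that[of x1] nonconst by (simp add: C_def V_def field_simps)
  have S_I: "u \<in> ?S" if "\<And>x. f (x + u) = c * f x + v" for c u v
    using that C_eq[of u c v] by simp
  have C_nz: "C u \<noteq> 0" if "u \<in> ?S" for u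
  proof
    assume "C u = 0"
    then have "f x = V u" for x
      using that by (auto dest!: spec[of _ "x - u"])
    then show False
      using nonconst by simp
  qed
  have diff: "u - w \<in> ?S" if "u \<in> ?S" "w \<in> ?S" for u w
  proof (rule S_I)
    fix x
    have "f (x + (u - w) + w) = C w * f (x + (u - w)) + V w"
      using that by blast
    moreover have "f (x + u) = C u * f x + V u"
      using that by blast
    ultimately have "f (x + (u - w)) = (C u * f x + (V u - V w)) / C w"
      using C_nz[OF that(2)] by (simp add: eq_divide_eq mult.commute)
    then show "f (x + (u - w)) = (C u / C w) * f x + (V u - V w) / C w"
      by (simp add: add_divide_distrib)
  qed
  \<comment> \<open>Every positive \<open>c\<close> is the factor of some \<open>u\<close> in
    \<open>?S\<close>; hence \<open>?S\<close> is uncountable.\<close>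
  have "{0<..} \<subseteq> C ` ?S"
  proof
    fix c :: real
    assume "c \<in> {0<..}"
    then obtain u v where "\<forall>x. f (x + u) = c * f x + v"
      using law[of c] unfolding greaterThan_iff by blast
    then show "c \<in> C ` ?S"
      using C_eq[of u c v] S_I[of u c v] by blast
  qed
  moreover have "uncountable {0::real<..}"
  proof
    assume "countable {0::real<..}"
    then have "countable {0::real<..<1}"
      by (rule countable_subset[rotated]) auto
    then show False
      using uncountable_open_interval[of 0 "1::real"] zero_less_one by blast
  qed
  ultimately have unc: "uncountable ?S"
    by (meson countable_image countable_subset)
  have "closed ?S"
    unfolding C_def V_def using nonconst
    by (intro closed_Collect_all closed_Collect_eq continuous_intros) auto
  then have "?S = UNIV"
    using uncountable_subgroup_real_small[OF unc diff]
    by (intro closed_subgroup_real_eq_UNIV diff) auto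
  then have all: "f (x + u) = C u * f x + V u" for x u
    by blast
  have C_mult: "C (u + w) = C u * C w" for u w
  proof -
    have "f (x + (u + w)) = (C u * C w) * f x + (C w * V u + V w)" for x
      using all[of x u] all[of "x + u" w] by (simp add: algebra_simps)
    then show ?thesis
      using C_eq by metis
  qed
  have C_pos: "C u > 0" for u
    using C_mult[of "u/2" "u/2"] C_nz[of "u/2"] \<open>?S = UNIV\<close> by (simp add: zero_less_mult_iff) linarith
  have "continuous_on UNIV C"
    unfolding C_def using nonconst by (intro continuous_intros) auto
  then obtain k where k: "\<And>u. C u = exp (k * u)"
    using continuous_multiplicative_imp_exp C_mult C_pos by blast
  \<comment> \<open>If \<open>k = 0\<close>, every factor would be 1, but the hypothesis supplies a
    law with factor 2.\<close>
  have "k \<noteq> 0"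
  proof
    assume "k = 0"
    obtain u v where "\<forall>x. f (x + u) = 2 * f x + v"
      using law[of 2] by auto
    then have "C u = 2"
      using C_eq[of u 2 v] by simp
    with \<open>k = 0\<close> k show False by simp
  qed
  \<comment> \<open>Expanding \<open>f (x + 1)\<close> and \<open>f (1 + x)\<close> by the two laws
    shows that \<open>f x - f 0\<close> is proportional to \<open>exp (k * x) - 1\<close>;
    \<open>b\<close> is the ratio, read off at \<open>x = 1\<close>.\<close>
  define b where "b = (f 1 - f 0) / (exp k - 1)"
  have "f x = (f 0 - b) + b * exp (k * x)" for x
  proof -
    have "f 1 = exp k * f 0 + V 1" "f x = exp (k * x) * f 0 + V x"
      "f (x + 1) = exp k * f x + V 1" "f (1 + x) = exp (k * x) * f 1 + V x"
      using all[of 0 1] all[of 0 x] all[of x 1] all[of 1 x] k by auto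
    then have "(f x - f 0) * (exp k - 1) = (f 1 - f 0) * (exp (k * x) - 1)"
      by (simp add: algebra_simps)
    then have "f x - f 0 = b * (exp (k * x) - 1)"
      using \<open>k \<noteq> 0\<close> by (simp add: b_def field_simps)
    then show ?thesis
      by (simp add: algebra_simps)
  qed
  then show ?thesis by blast
qed

section \<open>Plane isometries in coordinates\<close>

text \<open>Subtracting \<open>\<phi> 0\<close> leaves an isometry that fixes the origin, hence an
  orthogonal linear map; the columns of its matrix are the images of the unit vectors.\<close>

lemma plane_isometry_affine:
  assumes "plane_isometry \<phi>"
  obtains p q r s u v :: real
  where "\<And>x y. \<phi> (x, y) = (p * x + q * y + u, r * x + s * y + v)"
    and "p\<^sup>2 + r\<^sup>2 = 1" "q\<^sup>2 + s\<^sup>2 = 1" "p * q + r * s = 0"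
proof -
  define g where "g z = \<phi> z - \<phi> 0" for z
  have "dist (g v) (g w) = dist (\<phi> v) (\<phi> w)" for v w
    unfolding g_def dist_norm by simp
  then have "orthogonal_transformation g"
    using assms unfolding plane_isometry_def orthogonal_transformation_isometry
    by (simp add: g_def)
  then have lin: "linear g" and inner: "\<And>v w. inner (g v) (g w) = inner v w"
    unfolding orthogonal_transformation_def by auto
  obtain p r where pr: "g (1, 0) = (p, r)" by fastforce
  obtain q s where qs: "g (0, 1) = (q, s)" by fastforce
  obtain u v where uv: "\<phi> 0 = (u, v)" by fastforce
  have "\<phi> (x, y) = (p * x + q * y + u, r * x + s * y + v)" for x y
  proof -
    have "g (x, y) = g (x *\<^sub>R (1, 0) + y *\<^sub>R (0, 1))"
      by simp
    also have "\<dots> = x *\<^sub>R g (1, 0) + y *\<^sub>R g (0, 1)"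
      using lin by (simp only: linear_add linear_scale)
    finally have "g (x, y) = (p * x + q * y, r * x + s * y)"
      by (simp add: pr qs mult.commute)
    moreover have "\<phi> (x, y) = g (x, y) + \<phi> 0"
      by (simp add: g_def)
    ultimately show ?thesis
      by (simp add: uv)
  qed
  moreover have "p\<^sup>2 + r\<^sup>2 = 1" "q\<^sup>2 + s\<^sup>2 = 1" "p * q + r * s = 0"
    using inner[of "(1,0)" "(1,0)"] inner[of "(0,1)" "(0,1)"] inner[of "(1,0)" "(0,1)"]
    by (simp_all add: pr qs power2_eq_square)
  ultimately show ?thesis
    using that by blast
qed


section \<open>Chord slopes and their transformation under graph symmetries\<close>

text \<open>Chords take the place of tangents, since \<open>f\<close> is only continuous.\<close>

definition chord_slopes :: "(real \<Rightarrow> real) \<Rightarrow> real set" where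
  "chord_slopes f = {(f x - f y) / (x - y) |x y. x \<noteq> y}"

lemma connected_chord_slopes:
  fixes f :: "real \<Rightarrow> real"
  assumes "continuous_on UNIV f"
  shows "connected (chord_slopes f)"
proof -
  have [continuous_intros]: "continuous_on A (\<lambda>x. f (g x))" if "continuous_on A g"
    for A :: "(real \<times> real) set" and g
    using continuous_on_compose2[OF assms that] by auto
  let ?g = "\<lambda>p :: real \<times> real. (f (fst p + snd p) - f (fst p)) / snd p"
  \<comment> \<open>The pairs \<open>x \<noteq> y\<close> form a disconnected set. The slope ignores
    the order of the end points, so the left end point and the positive length suffice, and these
    range over a connected half plane.\<close>
  have "chord_slopes f = ?g ` (UNIV \<times> {0<..})"
  proof (intro equalityI subsetI)
    fix t
    assume "t \<in> chord_slopes f"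
    then obtain x y where xy: "x \<noteq> y" "t = (f x - f y) / (x - y)"
      unfolding chord_slopes_def by blast
    have "t = ?g (min x y, \<bar>x - y\<bar>)"
      using xy minus_divide_divide[of "f x - f y" "x - y"] by (auto simp: min_def abs_if)
    then show "t \<in> ?g ` (UNIV \<times> {0<..})"
      using xy by (intro image_eqI[of _ _ "(min x y, \<bar>x - y\<bar>)"]) auto
  next
    fix t
    assume "t \<in> ?g ` (UNIV \<times> {0<..})"
    then obtain x h where "h > 0" "t = (f (x + h) - f x) / h"
      by auto
    then show "t \<in> chord_slopes f"
      unfolding chord_slopes_def by (intro CollectI exI[of _ "x + h"] exI[of _ x]) auto
  qed
  moreover have "connected (?g ` (UNIV \<times> {0<..}))"
    by (intro connected_continuous_image continuous_intros connected_Times) auto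
  ultimately show ?thesis by simp
qed

text \<open>The affine map with matrix \<open>(p, q; r, s)\<close> and translation vector \<open>(u, v)\<close> maps the
  graph of \<open>f\<close> onto itself.\<close>

definition graph_symmetry :: "(real \<Rightarrow> real) \<Rightarrow> real \<Rightarrow> real \<Rightarrow> real \<Rightarrow> real \<Rightarrow> real \<Rightarrow> real \<Rightarrow> bool"
  where "graph_symmetry f p q r s u v \<longleftrightarrow>
    (\<forall>x. f (p * x + q * f x + u) = r * x + s * f x + v) \<and> (\<forall>X. \<exists>x. p * x + q * f x + u = X)"

text \<open>The linear part sends the direction \<open>(1, t)\<close> to
  \<open>(p + q * t, r + s * t)\<close>. The image is not vertical: two points of the graph with the
  same abscissa coincide, and an invertible linear part cannot collapse a chord.\<close>

lemma graph_symmetry_chord_slope: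
  assumes sym: "graph_symmetry f p q r s u v" and det: "p * s \<noteq> q * r"
    and "t \<in> chord_slopes f"
  shows "p + q * t \<noteq> 0" "(r + s * t) / (p + q * t) \<in> chord_slopes f"
proof -
  obtain x y where xy: "x \<noteq> y" "t = (f x - f y) / (x - y)"
    using assms unfolding chord_slopes_def by blast
  then have fxy: "f x - f y = t * (x - y)"
    by simp
  define X Y where "X = p * x + q * f x + u" and "Y = p * y + q * f y + u"
  have "X - Y = p * (x - y) + q * (f x - f y)"
    by (simp add: X_def Y_def algebra_simps)
  then have XY: "X - Y = (p + q * t) * (x - y)"
    unfolding fxy by (simp add: algebra_simps)
  have "f X = r * x + s * f x + v" "f Y = r * y + s * f y + v"
    using sym by (auto simp: graph_symmetry_def X_def Y_def)
  then have "f X - f Y = r * (x - y) + s * (f x - f y)"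
    by (simp add: algebra_simps)
  then have fXY: "f X - f Y = (r + s * t) * (x - y)"
    unfolding fxy by (simp add: algebra_simps)
  show nz: "p + q * t \<noteq> 0"
  proof
    assume 0: "p + q * t = 0"
    then have "X = Y" using XY by simp
    then have 1: "r + s * t = 0" using fXY xy by simp
    have "p * s - q * r = s * (p + q * t) - q * (r + s * t)"
      by (simp add: algebra_simps)
    then show False using 0 1 det by simp
  qed
  have "X \<noteq> Y" "(r + s * t) / (p + q * t) = (f X - f Y) / (X - Y)"
    using nz xy XY fXY by auto
  then show "(r + s * t) / (p + q * t) \<in> chord_slopes f"
    unfolding chord_slopes_def by blast
qed

text \<open>The symmetry is onto the graph, so both end points of a chord can be pulled
  back.\<close>

lemma graph_symmetry_chord_slope_preimage:
  assumes sym: "graph_symmetry f p q r s u v" and det: "p * s \<noteq> q * r"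
    and "\<sigma> \<in> chord_slopes f"
  obtains t where "t \<in> chord_slopes f" "p + q * t \<noteq> 0" "\<sigma> = (r + s * t) / (p + q * t)"
proof -
  obtain X Y where XY: "X \<noteq> Y" "\<sigma> = (f X - f Y) / (X - Y)"
    using assms unfolding chord_slopes_def by blast
  obtain x y where xy: "X = p * x + q * f x + u" "Y = p * y + q * f y + u"
    using sym unfolding graph_symmetry_def by metis
  have f: "f X = r * x + s * f x + v" "f Y = r * y + s * f y + v"
    using sym xy by (auto simp: graph_symmetry_def)
  have "x \<noteq> y" using xy XY by auto
  define t where "t = (f x - f y) / (x - y)"
  have t: "t \<in> chord_slopes f"
    using \<open>x \<noteq> y\<close> unfolding t_def chord_slopes_def by blast
  have fxy: "f x - f y = t * (x - y)"
    using \<open>x \<noteq> y\<close> by (simp add: t_def)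
  have "X - Y = p * (x - y) + q * (f x - f y)" "f X - f Y = r * (x - y) + s * (f x - f y)"
    unfolding f by (simp_all add: xy algebra_simps)
  then have "X - Y = (p + q * t) * (x - y)" "f X - f Y = (r + s * t) * (x - y)"
    unfolding fxy by (simp_all add: algebra_simps)
  then have "\<sigma> = (r + s * t) / (p + q * t)"
    using \<open>x \<noteq> y\<close> XY by simp
  with that t graph_symmetry_chord_slope(1)[OF sym det t] show ?thesis by blast
qed

text \<open>The Moebius map \<open>t \<mapsto> (r + s * t) / (p + q * t)\<close> is injective where
  it is defined, so the slope found by pulling a chord back is \<open>t\<close> itself.\<close>

lemma graph_symmetry_chord_slope_iff:
  assumes sym: "graph_symmetry f p q r s u v" and det: "p * s \<noteq> q * r"
  shows "t \<in> chord_slopes f \<longleftrightarrow> p + q * t \<noteq> 0 \<and> (r + s * t) / (p + q * t) \<in> chord_slopes f"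
proof
  assume R: "p + q * t \<noteq> 0 \<and> (r + s * t) / (p + q * t) \<in> chord_slopes f"
  then obtain t' where t': "t' \<in> chord_slopes f" "p + q * t' \<noteq> 0"
    "(r + s * t) / (p + q * t) = (r + s * t') / (p + q * t')"
    using graph_symmetry_chord_slope_preimage[OF sym det] by metis
  then have "(r + s * t) * (p + q * t') = (r + s * t') * (p + q * t)"
    using R by (simp add: frac_eq_eq)
  then have "(p * s - q * r) * (t - t') = 0"
    by (simp add: algebra_simps)
  then show "t \<in> chord_slopes f" using det t' by simp
qed (use graph_symmetry_chord_slope[OF assms] in blast)

text \<open>For \<open>q \<noteq> 0\<close>, the slope \<open>s / q\<close> is that of the image of
  the vertical direction, so no finite slope is mapped to it.\<close>

lemma graph_symmetry_chord_slopes_UNIV: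
  assumes sym: "graph_symmetry f p q r s u v" and det: "p * s \<noteq> q * r"
    and "chord_slopes f = UNIV"
  shows "q = 0"
proof (rule ccontr)
  assume "q \<noteq> 0"
  obtain t where t: "p + q * t \<noteq> 0" "s / q = (r + s * t) / (p + q * t)"
    using graph_symmetry_chord_slope_preimage[OF sym det, of "s / q"] assms by auto
  then have "s * (p + q * t) = (r + s * t) * q"
    using \<open>q \<noteq> 0\<close> by (simp add: frac_eq_eq)
  then show False using det by (simp add: algebra_simps)
qed

section \<open>Slope sets that are rays\<close>

text \<open>The polynomial vanishes at \<open>\<alpha>\<close> by continuity. Its cofactor is affine
  and nonnegative away from \<open>\<alpha>\<close>, hence constant.\<close>

lemma quadratic_sign_change:
  fixes a b c \<alpha> :: real
  assumes pos: "\<And>t. t > \<alpha> \<Longrightarrow> a + b * t + c * t\<^sup>2 \<ge> 0"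
    and neg: "\<And>t. t < \<alpha> \<Longrightarrow> a + b * t + c * t\<^sup>2 \<le> 0"
  shows "c = 0" "a + b * \<alpha> = 0"
proof -
  let ?P = "\<lambda>t. a + b * t + c * t\<^sup>2"
  have "?P \<alpha> \<ge> 0"
  proof (rule tendsto_lowerbound)
    show "(?P \<longlongrightarrow> ?P \<alpha>) (at_right \<alpha>)"
      by (intro tendsto_intros)
    show "eventually (\<lambda>t. 0 \<le> ?P t) (at_right \<alpha>)"
      using pos by (auto simp: eventually_at_filter)
  qed simp
  moreover have "?P \<alpha> \<le> 0"
  proof (rule tendsto_upperbound)
    show "(?P \<longlongrightarrow> ?P \<alpha>) (at_left \<alpha>)"
      by (intro tendsto_intros)
    show "eventually (\<lambda>t. ?P t \<le> 0) (at_left \<alpha>)"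
      using neg by (auto simp: eventually_at_filter)
  qed simp
  ultimately have zero: "?P \<alpha> = 0" by simp
  have factor: "?P t = (t - \<alpha>) * (b + c * \<alpha> + c * t)" for t
  proof -
    have "?P t = ?P t - ?P \<alpha>" using zero by simp
    also have "\<dots> = (t - \<alpha>) * (b + c * \<alpha> + c * t)"
      by (simp add: algebra_simps power2_eq_square)
    finally show ?thesis .
  qed
  have nonneg: "b + c * \<alpha> + c * t \<ge> 0" if "t \<noteq> \<alpha>" for t
    using pos[of t] neg[of t] that unfolding factor
    by (cases "t > \<alpha>") (auto simp: zero_le_mult_iff mult_le_0_iff)
  show "c = 0"
  proof (rule ccontr)
    assume "c \<noteq> 0"
    \<comment> \<open>Two points with negative cofactor are taken because one of them might be
      \<open>\<alpha>\<close>.\<close>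
    define t1 t2 where "t1 = - (b + c * \<alpha> + 1) / c" and "t2 = - (b + c * \<alpha> + 2) / c"
    have "b + c * \<alpha> + c * t1 = -1" "b + c * \<alpha> + c * t2 = -2"
      using \<open>c \<noteq> 0\<close> by (simp_all add: t1_def t2_def)
    then show False using nonneg[of t1] nonneg[of t2] by force
  qed
  with zero show "a + b * \<alpha> = 0" by simp
qed

lemma graph_symmetry_chord_slopes_ray:
  assumes sym: "graph_symmetry f p (q * c) r (s * c) u v"
    and orth: "p\<^sup>2 + r\<^sup>2 = 1" "q\<^sup>2 + s\<^sup>2 = 1" "p * q + r * s = 0"
    and det: "p * (s * c) \<noteq> q * c * r"
    and c: "c > 0" "c \<noteq> 1"
    and ray: "(\<forall>t. (t > \<alpha> \<longrightarrow> t \<in> chord_slopes f) \<and> (t < \<alpha> \<longrightarrow> t \<notin> chord_slopes f)) \<or>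
      (\<forall>t. (t < \<alpha> \<longrightarrow> t \<in> chord_slopes f) \<and> (t > \<alpha> \<longrightarrow> t \<notin> chord_slopes f))"
  shows "q = 0 \<and> r = 0 \<or> p = 0 \<and> s = 0"
proof -
  \<comment> \<open>The pullback of the form \<open>x (y - \<alpha> x)\<close> under the linear part, evaluated at \<open>(1, t)\<close>: the form
    vanishes exactly in the end directions of the arc of slopes, so the pullback changes sign at
    \<open>t = \<alpha>\<close> only.\<close>
  define a0 a1 a2 where "a0 = p * (r - \<alpha> * p)"
    and "a1 = c * (p * (s - \<alpha> * q) + q * (r - \<alpha> * p))" and "a2 = c\<^sup>2 * (q * (s - \<alpha> * q))"
  define A B where "A t = p + q * c * t" and "B t = r + s * c * t" for t
  note iff = graph_symmetry_chord_slope_iff[OF sym det, folded A_def B_def]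
  have N: "a0 + a1 * t + a2 * t\<^sup>2 = A t * (B t - \<alpha> * A t)" for t
    unfolding a0_def a1_def a2_def A_def B_def by (simp add: algebra_simps power2_eq_square)
  have sq: "A t * (B t - \<alpha> * A t) = (A t)\<^sup>2 * (B t / A t - \<alpha>)" if "A t \<noteq> 0" for t
    using that by (simp add: field_simps power2_eq_square)
  have "a2 = 0 \<and> a0 + a1 * \<alpha> = 0"
    using ray
  proof
    assume *: "\<forall>t. (t > \<alpha> \<longrightarrow> t \<in> chord_slopes f) \<and> (t < \<alpha> \<longrightarrow> t \<notin> chord_slopes f)"
    have "a0 + a1 * t + a2 * t\<^sup>2 \<ge> 0" if "t > \<alpha>" for t
    proof -
      have A: "A t \<noteq> 0" and "B t / A t \<in> chord_slopes f"
        using * that iff by blast+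
      then have "B t / A t \<ge> \<alpha>"
        using * by (meson linorder_not_less)
      then show ?thesis
        unfolding N sq[OF A] by simp
    qed
    moreover have "a0 + a1 * t + a2 * t\<^sup>2 \<le> 0" if "t < \<alpha>" for t
    proof (cases "A t = 0")
      case False
      then have "B t / A t \<notin> chord_slopes f"
        using * that iff by blast
      then have "B t / A t \<le> \<alpha>"
        using * by (meson linorder_not_less)
      then show ?thesis
        unfolding N sq[OF False] by (simp add: mult_nonneg_nonpos)
    qed (simp add: N)
    ultimately show ?thesis
      using quadratic_sign_change by blast
  next
    assume *: "\<forall>t. (t < \<alpha> \<longrightarrow> t \<in> chord_slopes f) \<and> (t > \<alpha> \<longrightarrow> t \<notin> chord_slopes f)"
    have "a0 + a1 * t + a2 * t\<^sup>2 \<le> 0" if "t < \<alpha>" for t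
    proof -
      have A: "A t \<noteq> 0" and "B t / A t \<in> chord_slopes f"
        using * that iff by blast+
      then have "B t / A t \<le> \<alpha>"
        using * by (meson linorder_not_less)
      then show ?thesis
        unfolding N sq[OF A] by (simp add: mult_nonneg_nonpos)
    qed
    moreover have "a0 + a1 * t + a2 * t\<^sup>2 \<ge> 0" if "t > \<alpha>" for t
    proof (cases "A t = 0")
      case False
      then have "B t / A t \<notin> chord_slopes f"
        using * that iff by blast
      then have "B t / A t \<ge> \<alpha>"
        using * by (meson linorder_not_less)
      then show ?thesis
        unfolding N sq[OF False] by simp
    qed (simp add: N)
    ultimately show ?thesis
      using quadratic_sign_change by blast
  qed
  then have a: "a2 = 0" "a0 + a1 * \<alpha> = 0"
    by auto
  \<comment> \<open>The value of the form at the image of the vertical direction: this image is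
    again vertical, or it has slope \<open>\<alpha>\<close>.\<close>
  then have qs: "q * (s - \<alpha> * q) = 0"
    using c by (simp add: a2_def)
  \<comment> \<open>Likewise, the direction of slope \<open>\<alpha>\<close> goes to an end
    direction.\<close>
  have N0: "A \<alpha> * (B \<alpha> - \<alpha> * A \<alpha>) = 0"
    using N[of \<alpha>] unfolding a by simp
  show ?thesis
  proof (cases "q = 0")
    case True
    then show ?thesis using orth by auto
  next
    case False
    then have s: "s = \<alpha> * q" using qs by simp
    have "q * (p + \<alpha> * r) = 0"
      using orth(3) by (simp add: s algebra_simps)
    then have p: "p = - \<alpha> * r" using False by simp
    have q2: "q\<^sup>2 * (1 + \<alpha>\<^sup>2) = 1" and r2: "r\<^sup>2 * (1 + \<alpha>\<^sup>2) = 1"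
      using orth by (simp_all add: s p algebra_simps power_mult_distrib)
    have "A \<alpha> * (B \<alpha> - \<alpha> * A \<alpha>) = \<alpha> * (q * c - r) * (r * (1 + \<alpha>\<^sup>2))"
      unfolding A_def B_def by (simp add: s p algebra_simps power2_eq_square)
    moreover have "r * (1 + \<alpha>\<^sup>2) \<noteq> 0"
      using r2 by (auto simp: power2_eq_square)
    ultimately have "\<alpha> = 0 \<or> r = q * c"
      using N0 by auto
    \<comment> \<open>\<open>(p, r)\<close> and \<open>(q, s)\<close> are unit vectors, so here
      \<open>q\<close> and \<open>r\<close> have the same absolute value, and
      \<open>r = q * c\<close> would force \<open>c = 1\<close>.\<close>
    moreover have "r \<noteq> q * c"
    proof
      assume "r = q * c"
      then have "q\<^sup>2 * (1 + \<alpha>\<^sup>2) * c\<^sup>2 = 1"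
        using r2 by (simp add: power_mult_distrib algebra_simps)
      then have "c\<^sup>2 = 1" using q2 by simp
      then show False using c by (simp add: power2_eq_1_iff)
    qed
    ultimately show ?thesis by (simp add: s p)
  qed
qed


section \<open>Bounded slope sets\<close>

text \<open>A quantitative form of the shrinking arc: comparing areas bounds the distance of two
  slopes by \<open>2 * B * K * c\<close> with \<open>K = 1 + B\<^sup>2\<close>, for a symmetry
  belonging to \<open>c\<close>.\<close>

lemma bounded_chord_slopes_eq:
  fixes f :: "real \<Rightarrow> real"
  assumes sym: "\<And>c. c > 0 \<Longrightarrow> \<exists>p q r s u v. graph_symmetry f p (q * c) r (s * c) u v \<and>
      p\<^sup>2 + r\<^sup>2 = 1 \<and> q\<^sup>2 + s\<^sup>2 = 1 \<and> p * q + r * s = 0 \<and> (p * s - q * r)\<^sup>2 = 1"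
    and bound: "\<And>t. t \<in> chord_slopes f \<Longrightarrow> \<bar>t\<bar> \<le> B"
    and \<sigma>: "\<sigma>1 \<in> chord_slopes f" "\<sigma>2 \<in> chord_slopes f"
  shows "\<sigma>1 = \<sigma>2"
proof (rule ccontr)
  assume "\<sigma>1 \<noteq> \<sigma>2"
  define \<delta> where "\<delta> = \<bar>\<sigma>2 - \<sigma>1\<bar>"
  have "\<delta> > 0" using \<open>\<sigma>1 \<noteq> \<sigma>2\<close> by (simp add: \<delta>_def)
  have "B \<ge> 0" using bound[OF \<sigma>(1)] by linarith
  define K where "K = 1 + B\<^sup>2"
  have "K > 0" by (simp add: K_def add_pos_nonneg)
  \<comment> \<open>Chosen so that the final bound falls below \<open>\<delta>\<close>;
    \<open>B + 1\<close> instead of \<open>B\<close> keeps the denominator positive when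
    \<open>B = 0\<close> and makes the inequality strict.\<close>
  define c where "c = \<delta> / (2 * (B + 1) * K)"
  have "c > 0"
    using \<open>\<delta> > 0\<close> \<open>B \<ge> 0\<close> \<open>K > 0\<close> by (simp add: c_def)
  then obtain p q r s u v where sym: "graph_symmetry f p (q * c) r (s * c) u v"
    and orth: "p\<^sup>2 + r\<^sup>2 = 1" "q\<^sup>2 + s\<^sup>2 = 1" "p * q + r * s = 0" and det: "(p * s - q * r)\<^sup>2 = 1"
    using assms(1) by blast
  have "(p * s - q * r) * c \<noteq> 0"
    using det \<open>c > 0\<close> by auto
  then have det': "p * (s * c) \<noteq> q * c * r"
    by (simp add: algebra_simps)
  define a where "a t = p + q * c * t" for t
  define b where "b t = r + s * c * t" for t
  \<comment> \<open>\<open>(a t, b t)\<close> is the image of \<open>(1, c * t)\<close> under an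
    orthogonal matrix, so its length is at least 1; as its slope is at most \<open>B\<close> in
    absolute value, the first coordinate cannot be small.\<close>
  have lower: "(a t)\<^sup>2 * K \<ge> 1" if "\<bar>\<sigma>\<bar> \<le> B" "a t \<noteq> 0" "\<sigma> = b t / a t" for t \<sigma>
  proof -
    have "(a t)\<^sup>2 + (b t)\<^sup>2 = (p\<^sup>2 + r\<^sup>2) + 2 * (c * t) * (p * q + r * s) + (c * t)\<^sup>2 * (q\<^sup>2 + s\<^sup>2)"
      by (simp add: a_def b_def power2_eq_square algebra_simps)
    then have "1 \<le> (a t)\<^sup>2 + (b t)\<^sup>2"
      unfolding orth by simp
    also have "\<dots> = (a t)\<^sup>2 * (1 + \<sigma>\<^sup>2)"
      using that by (simp add: power_divide distrib_left)
    also have "\<dots> \<le> (a t)\<^sup>2 * K"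
      using that abs_le_square_iff[of \<sigma> B] \<open>B \<ge> 0\<close> by (intro mult_left_mono) (auto simp: K_def)
    finally show ?thesis .
  qed
  obtain t1 where t1: "t1 \<in> chord_slopes f" "a t1 \<noteq> 0" "\<sigma>1 = b t1 / a t1"
    using graph_symmetry_chord_slope_preimage[OF sym det' \<sigma>(1)] unfolding a_def b_def by metis
  obtain t2 where t2: "t2 \<in> chord_slopes f" "a t2 \<noteq> 0" "\<sigma>2 = b t2 / a t2"
    using graph_symmetry_chord_slope_preimage[OF sym det' \<sigma>(2)] unfolding a_def b_def by metis
  \<comment> \<open>The area spanned by two chord directions is preserved up to sign.\<close>
  have "a t1 * a t2 * (\<sigma>2 - \<sigma>1) = a t1 * b t2 - a t2 * b t1"
    using t1 t2 by (simp add: right_diff_distrib)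
  also have "\<dots> = c * (p * s - q * r) * (t2 - t1)"
    by (simp add: a_def b_def algebra_simps)
  finally have "(a t1 * a t2 * (\<sigma>2 - \<sigma>1))\<^sup>2 = (c * (p * s - q * r) * (t2 - t1))\<^sup>2"
    by (rule arg_cong)
  then have area: "(a t1)\<^sup>2 * (a t2)\<^sup>2 * \<delta>\<^sup>2 = c\<^sup>2 * (t2 - t1)\<^sup>2"
    by (simp add: power_mult_distrib det \<delta>_def)
  have "\<bar>t2 - t1\<bar> \<le> \<bar>2 * B\<bar>"
    using bound[OF t1(1)] bound[OF t2(1)] by linarith
  then have t_diff: "(t2 - t1)\<^sup>2 \<le> (2 * B)\<^sup>2"
    by (simp only: abs_le_square_iff)
  have "1 * 1 \<le> ((a t1)\<^sup>2 * K) * ((a t2)\<^sup>2 * K)"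
    using lower[OF bound[OF \<sigma>(1)] t1(2,3)] lower[OF bound[OF \<sigma>(2)] t2(2,3)] by (intro mult_mono) auto
  then have "1 * \<delta>\<^sup>2 \<le> (((a t1)\<^sup>2 * K) * ((a t2)\<^sup>2 * K)) * \<delta>\<^sup>2"
    by (intro mult_right_mono) auto
  also have "\<dots> = K\<^sup>2 * ((a t1)\<^sup>2 * (a t2)\<^sup>2 * \<delta>\<^sup>2)"
    by (simp add: power2_eq_square algebra_simps)
  also have "\<dots> \<le> K\<^sup>2 * (c\<^sup>2 * (2 * B)\<^sup>2)"
    unfolding area using t_diff by (intro mult_left_mono) auto
  also have "\<dots> = (2 * B * K * c)\<^sup>2"
    by (simp add: power_mult_distrib)
  finally have "\<delta> \<le> 2 * B * K * c"
    using \<open>B \<ge> 0\<close> \<open>K > 0\<close> \<open>c > 0\<close> by (auto intro: power2_le_imp_le)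
  moreover have "2 * (B + 1) * K * c = \<delta>"
    using \<open>B \<ge> 0\<close> \<open>K > 0\<close> by (simp add: c_def)
  moreover have "2 * B * K * c < 2 * (B + 1) * K * c"
    using \<open>K > 0\<close> \<open>c > 0\<close> by simp
  ultimately show False by simp
qed

section \<open>From axis-permuting symmetries to translation laws\<close>

text \<open>Applying a symmetry with diagonal linear part twice removes the signs and squares the
  factor. So it suffices to find such a symmetry for the square root of \<open>c\<close>.\<close>

lemma axis_preserving_imp_translation_law:
  fixes f :: "real \<Rightarrow> real"
  assumes sym: "\<And>c. c > 0 \<Longrightarrow> c \<noteq> 1 \<Longrightarrow> \<exists>p q r s u v. graph_symmetry f p (q * c) r (s * c) u v \<and>
      (q = 0 \<and> r = 0 \<and> p\<^sup>2 = 1 \<and> s\<^sup>2 = 1 \<or> p = 0 \<and> s = 0 \<and> q\<^sup>2 = 1 \<and> r\<^sup>2 = 1)"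
    and "c > 0"
  shows "\<exists>u v. \<forall>x. f (x + u) = c * f x + v"
proof (cases "c = 1")
  case True
  then show ?thesis by (intro exI[of _ 0]) simp
next
  case False
  \<comment> \<open>\<open>straight\<close> and \<open>swapped\<close> stand for a diagonal and an
    antidiagonal linear part; \<open>\<epsilon>\<close> and \<open>\<delta>\<close> are
    signs.\<close>
  define straight where "straight c \<longleftrightarrow>
    (\<exists>\<epsilon> \<delta> m n. \<epsilon>\<^sup>2 = 1 \<and> \<delta>\<^sup>2 = 1 \<and> (\<forall>x. f (\<epsilon> * x + m) = \<delta> * c * f x + n))" for c
  define swapped where "swapped c \<longleftrightarrow>
    (\<exists>\<epsilon> \<delta> m n. \<epsilon>\<^sup>2 = 1 \<and> \<delta>\<^sup>2 = 1 \<and> (\<forall>x. f (\<delta> * c * f x + m) = \<epsilon> * x + n))" for c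
  have either: "straight c \<or> swapped c" if c: "c > 0" "c \<noteq> 1" for c
  proof -
    obtain p q r s u v where *: "graph_symmetry f p (q * c) r (s * c) u v"
      "q = 0 \<and> r = 0 \<and> p\<^sup>2 = 1 \<and> s\<^sup>2 = 1 \<or> p = 0 \<and> s = 0 \<and> q\<^sup>2 = 1 \<and> r\<^sup>2 = 1"
      using sym[OF c] by blast
    from *(2) show ?thesis
    proof
      assume "q = 0 \<and> r = 0 \<and> p\<^sup>2 = 1 \<and> s\<^sup>2 = 1"
      then have "straight c"
        using *(1) unfolding straight_def graph_symmetry_def
        by (intro exI[of _ p] exI[of _ s] exI[of _ u] exI[of _ v]) simp
      then show ?thesis ..
    next
      assume "p = 0 \<and> s = 0 \<and> q\<^sup>2 = 1 \<and> r\<^sup>2 = 1"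
      then have "swapped c"
        using *(1) unfolding swapped_def graph_symmetry_def
        by (intro exI[of _ r] exI[of _ q] exI[of _ u] exI[of _ v]) simp
      then show ?thesis ..
    qed
  qed
  have square: "\<exists>u v. \<forall>x. f (x + u) = c\<^sup>2 * f x + v" if straight: "straight c" for c
  proof -
    obtain \<epsilon> \<delta> m n where *: "\<epsilon>\<^sup>2 = 1" "\<delta>\<^sup>2 = 1" "\<And>x. f (\<epsilon> * x + m) = \<delta> * c * f x + n"
      using straight unfolding straight_def by blast
    have "f (x + (\<epsilon> * m + m)) = c\<^sup>2 * f x + (\<delta> * c * n + n)" for x
    proof -
      have "x + (\<epsilon> * m + m) = \<epsilon> * (\<epsilon> * x + m) + m"
        using *(1) by (simp add: power2_eq_square distrib_left flip: mult.assoc)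
      then have "f (x + (\<epsilon> * m + m)) = \<delta> * c * (\<delta> * c * f x + n) + n"
        by (simp only: *(3))
      also have "\<dots> = \<delta>\<^sup>2 * c\<^sup>2 * f x + (\<delta> * c * n + n)"
        by (simp add: power2_eq_square algebra_simps)
      finally show ?thesis using *(2) by simp
    qed
    then show ?thesis by blast
  qed
  have straight_square: "straight (c\<^sup>2)" if c: "straight c" for c
  proof -
    obtain u v where "\<forall>x. f (x + u) = c\<^sup>2 * f x + v"
      using square[OF c] by blast
    then show ?thesis
      unfolding straight_def
      by (intro exI[of _ 1] exI[of _ u] exI[of _ v]) simp
  qed
  \<comment> \<open>Composing one swapped symmetry with the inverse of another restores the axes and
    divides the factors.\<close>
  have quotient: "straight (c / d)" if swapped: "swapped c" "swapped d" and "d > 0" for c d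
  proof -
    obtain \<epsilon> \<delta> m n where c: "\<epsilon>\<^sup>2 = 1" "\<delta>\<^sup>2 = 1" "\<And>x. f (\<delta> * c * f x + m) = \<epsilon> * x + n"
      using swapped unfolding swapped_def by blast
    obtain \<epsilon>' \<delta>' m' n' where d: "\<epsilon>'\<^sup>2 = 1" "\<delta>'\<^sup>2 = 1" "\<And>x. f (\<delta>' * d * f x + m') = \<epsilon>' * x + n'"
      using swapped unfolding swapped_def by blast
    have inj: "x = y" if "f x = f y" for x y
      using c(1) c(3)[of x] c(3)[of y] that by auto
    have "f ((\<epsilon>' * \<epsilon>) * x + \<epsilon>' * (n - n')) = (\<delta>' * \<delta>) * (c / d) * f x + \<delta>' * (m - m') / d" for x
    proof -
      \<comment> \<open>The solution of \<open>\<epsilon>' * ?y + n' = \<epsilon> * x + n\<close>,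
        which equates the right-hand sides of the two laws; injectivity of \<open>f\<close> then
        equates the arguments on the left.\<close>
      let ?y = "(\<epsilon>' * \<epsilon>) * x + \<epsilon>' * (n - n')"
      have "f (\<delta>' * d * f ?y + m') = \<epsilon>'\<^sup>2 * (\<epsilon> * x + n - n') + n'"
        unfolding d(3) by (simp add: power2_eq_square algebra_simps)
      then have "f (\<delta>' * d * f ?y + m') = f (\<delta> * c * f x + m)"
        by (simp add: d(1) c(3))
      then have "\<delta>' * d * f ?y + m' = \<delta> * c * f x + m"
        by (rule inj)
      then have "\<delta>' * d * f ?y = \<delta> * c * f x + m - m'"
        by linarith
      then have "\<delta>' * (\<delta>' * d * f ?y) = \<delta>' * (\<delta> * c * f x + m - m')"
        by (simp only:)
      moreover have "\<delta>' * (\<delta>' * d * f ?y) = \<delta>'\<^sup>2 * (f ?y * d)"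
        by (simp add: power2_eq_square)
      ultimately have "f ?y * d = \<delta>' * (\<delta> * c * f x + m - m')"
        unfolding d(2) by linarith
      then have "f ?y = \<delta>' * (\<delta> * c * f x + m - m') / d"
        using \<open>d > 0\<close> by (simp only: eq_divide_eq) simp
      then show ?thesis
        by (simp add: add_divide_distrib diff_divide_distrib algebra_simps)
    qed
    moreover have "(\<epsilon>' * \<epsilon>)\<^sup>2 = 1" "(\<delta>' * \<delta>)\<^sup>2 = 1"
      using c d by (simp_all add: power_mult_distrib)
    ultimately show ?thesis
      unfolding straight_def by blast
  qed
  \<comment> \<open>A swapped symmetry for \<open>c\<close> is avoided by passing to roots: if neither \<open>w\<close> nor \<open>s = w\<^sup>2\<close>
    were straight, their quotient \<open>w\<close> would be.\<close>
  define s w where "s = sqrt c" and "w = sqrt s"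
  have sw: "s > 0" "w > 0" "s \<noteq> 1" "w \<noteq> 1" "s\<^sup>2 = c" "w\<^sup>2 = s"
    using \<open>c > 0\<close> False by (simp_all add: s_def w_def)
  have "s / w = w"
    using sw by (simp add: power2_eq_square divide_eq_eq)
  then have "straight w \<or> straight s"
    using either[of w] either[of s] quotient[of s w] sw by auto
  then have "straight s"
    using straight_square[of w] sw by auto
  then show ?thesis
    using square[of s] sw by simp
qed

section \<open>Rigid continuous functions are affine or exponential\<close>

text \<open>The graph of \<open>c f\<close> is the graph of \<open>f\<close> stretched vertically by
  \<open>c\<close>. Preceding the isometry by this stretch gives a symmetry of the graph of
  \<open>f\<close>, with the second matrix column multiplied by \<open>c\<close>.\<close>

lemma vertically_rigid_graph_symmetry:
  assumes "vertically_rigid f" "c > 0"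
  shows "\<exists>p q r s u v. graph_symmetry f p (q * c) r (s * c) u v \<and>
      p\<^sup>2 + r\<^sup>2 = 1 \<and> q\<^sup>2 + s\<^sup>2 = 1 \<and> p * q + r * s = 0 \<and> (p * s - q * r)\<^sup>2 = 1"
proof -
  obtain \<phi> where iso: "plane_isometry \<phi>"
    and \<phi>: "\<phi> ` fun_graph (\<lambda>x. c * f x) = fun_graph f"
    using assms unfolding vertically_rigid_def isometric_sets_def by blast
  obtain p q r s u v where
    eq: "\<And>x y. \<phi> (x, y) = (p * x + q * y + u, r * x + s * y + v)"
    and orth: "p\<^sup>2 + r\<^sup>2 = 1" "q\<^sup>2 + s\<^sup>2 = 1" "p * q + r * s = 0"
    using plane_isometry_affine[OF iso] by metis
  have "(p * s - q * r)\<^sup>2 = (p\<^sup>2 + r\<^sup>2) * (q\<^sup>2 + s\<^sup>2) - (p * q + r * s)\<^sup>2"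
    by (simp add: power2_eq_square algebra_simps)
  then have det: "(p * s - q * r)\<^sup>2 = 1"
    unfolding orth by simp
  have graph: "fun_graph h = range (\<lambda>x. (x, h x))" for h
    unfolding fun_graph_def by auto
  have "range (\<lambda>x. (p * x + q * c * f x + u, r * x + s * c * f x + v)) = range (\<lambda>x. (x, f x))"
    using \<phi> unfolding graph image_image eq by (simp only: mult.assoc)
  then have "(p * x + q * c * f x + u, r * x + s * c * f x + v) \<in> range (\<lambda>x. (x, f x))"
    and "(X, f X) \<in> range (\<lambda>x. (p * x + q * c * f x + u, r * x + s * c * f x + v))" for x X
    by blast+
  then have "graph_symmetry f p (q * c) r (s * c) u v"
    unfolding graph_symmetry_def by (auto simp: image_iff) metis
  then show ?thesis using orth det by blast
qed

lemma vertically_rigid_imp: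
  fixes f :: "real \<Rightarrow> real"
  assumes cont: "continuous_on UNIV f" and rigid: "vertically_rigid f"
  shows "\<exists>a b k. (\<forall>x. f x = a + b * x) \<or> (\<forall>x. f x = a + b * exp (k * x))"
proof (cases "\<exists>b. chord_slopes f \<subseteq> {b}")
  case True
  then obtain b where b: "chord_slopes f \<subseteq> {b}" ..
  have "f x = f 0 + b * x" for x
  proof (cases "x = 0")
    case False
    then have "(f x - f 0) / (x - 0) \<in> chord_slopes f"
      unfolding chord_slopes_def by blast
    then have "(f x - f 0) / x = b" using b by auto
    then show ?thesis using False by (simp add: divide_eq_eq)
  qed simp
  then show ?thesis by blast
next
  case False
  let ?S = "chord_slopes f"
  note sym = vertically_rigid_graph_symmetry[OF rigid]
  have interval: "t \<in> ?S" if "a \<in> ?S" "b \<in> ?S" "a < t" "t < b" for a b t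
    using connected_contains_Icc[OF connected_chord_slopes[OF cont] that(1,2)] that(3,4) by auto
  obtain \<sigma>0 where \<sigma>0: "\<sigma>0 \<in> ?S" using False by blast
  have "\<not> (bdd_above ?S \<and> bdd_below ?S)"
  proof
    assume "bdd_above ?S \<and> bdd_below ?S"
    then obtain M m where Mm: "\<And>t. t \<in> ?S \<Longrightarrow> t \<le> M" "\<And>t. t \<in> ?S \<Longrightarrow> m \<le> t"
      unfolding bdd_above_def bdd_below_def by blast
    have "\<bar>t\<bar> \<le> max \<bar>M\<bar> \<bar>m\<bar>" if "t \<in> ?S" for t
      using Mm[OF that] by linarith
    then have "?S \<subseteq> {\<sigma>0}"
      using bounded_chord_slopes_eq[OF sym] \<sigma>0 by blast
    then show False using False by blast
  qed
  then consider "\<not> bdd_above ?S" "\<not> bdd_below ?S" | "\<not> bdd_above ?S" "bdd_below ?S"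
    | "bdd_above ?S" "\<not> bdd_below ?S"
    by argo
  \<comment> \<open>An unbounded interval is the whole line or a ray; whether the end point of the
    ray belongs to it is left open.\<close>
  then have "?S = UNIV \<or> (\<exists>\<alpha>. (\<forall>t. (t > \<alpha> \<longrightarrow> t \<in> ?S) \<and> (t < \<alpha> \<longrightarrow> t \<notin> ?S)) \<or>
      (\<forall>t. (t < \<alpha> \<longrightarrow> t \<in> ?S) \<and> (t > \<alpha> \<longrightarrow> t \<notin> ?S)))"
  proof cases
    case 1
    have "t \<in> ?S" for t
      using 1 interval unfolding bdd_above_def bdd_below_def by (meson linorder_not_le)
    then show ?thesis by blast
  next
    case 2
    have "t \<in> ?S" if "t > Inf ?S" for t
      using 2 interval \<sigma>0 that cInf_less_iff[of ?S t] unfolding bdd_above_def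
      by (metis empty_iff linorder_not_le)
    moreover have "t \<notin> ?S" if "t < Inf ?S" for t
      using 2 that cInf_lower[of t ?S] by auto
    ultimately show ?thesis by blast
  next
    case 3
    have "t \<in> ?S" if "t < Sup ?S" for t
      using 3 interval \<sigma>0 that less_cSup_iff[of ?S t] unfolding bdd_below_def
      by (metis empty_iff linorder_not_le)
    moreover have "t \<notin> ?S" if "t > Sup ?S" for t
      using 3 that cSup_upper[of t ?S] by auto
    ultimately show ?thesis by blast
  qed
  note shape = this
  have "\<exists>p q r s u v. graph_symmetry f p (q * c) r (s * c) u v \<and>
      (q = 0 \<and> r = 0 \<and> p\<^sup>2 = 1 \<and> s\<^sup>2 = 1 \<or> p = 0 \<and> s = 0 \<and> q\<^sup>2 = 1 \<and> r\<^sup>2 = 1)"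
    if c: "c > 0" "c \<noteq> 1" for c
  proof -
    obtain p q r s u v where gs: "graph_symmetry f p (q * c) r (s * c) u v"
      and orth: "p\<^sup>2 + r\<^sup>2 = 1" "q\<^sup>2 + s\<^sup>2 = 1" "p * q + r * s = 0" and det: "(p * s - q * r)\<^sup>2 = 1"
      using sym[OF c(1)] by blast
    have "(p * s - q * r) * c \<noteq> 0"
      using det c by auto
    then have det': "p * (s * c) \<noteq> q * c * r"
      by (simp add: algebra_simps)
    from shape have "q = 0 \<and> r = 0 \<or> p = 0 \<and> s = 0"
    proof
      assume "?S = UNIV"
      then have "q = 0"
        using graph_symmetry_chord_slopes_UNIV[OF gs det'] c by simp
      then show ?thesis using orth by auto
    next
      assume "\<exists>\<alpha>. (\<forall>t. (t > \<alpha> \<longrightarrow> t \<in> ?S) \<and> (t < \<alpha> \<longrightarrow> t \<notin> ?S)) \<or>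
        (\<forall>t. (t < \<alpha> \<longrightarrow> t \<in> ?S) \<and> (t > \<alpha> \<longrightarrow> t \<notin> ?S))"
      then show ?thesis
        using graph_symmetry_chord_slopes_ray[OF gs orth det' c] by blast
    qed
    then have "q = 0 \<and> r = 0 \<and> p\<^sup>2 = 1 \<and> s\<^sup>2 = 1 \<or> p = 0 \<and> s = 0 \<and> q\<^sup>2 = 1 \<and> r\<^sup>2 = 1"
      using orth by auto
    then show ?thesis using gs by blast
  qed
  then have law: "\<exists>u v. \<forall>x. f (x + u) = c * f x + v" if "c > 0" for c
    using axis_preserving_imp_translation_law that by blast
  have "\<exists>x. f x \<noteq> f 0"
  proof (rule ccontr)
    assume "\<not> ?thesis"
    then have "f x = f 0" for x by blast
    then have "?S \<subseteq> {0}"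
      unfolding chord_slopes_def by auto (metis diff_self)
    then show False using False by blast
  qed
  then show ?thesis
    using translation_law_imp_exp[OF cont law] by blast
qed

section \<open>The converse: explicit isometries\<close>

text \<open>Rotations followed by translations provide all isometries that the converse
  uses.\<close>

lemma plane_isometry_rigid_motion:
  fixes p q :: real
  assumes "p\<^sup>2 + q\<^sup>2 = 1"
  shows "plane_isometry (\<lambda>(x, y). (p * x - q * y + u, q * x + p * y + v))" (is "plane_isometry ?\<phi>")
proof -
  have dist: "dist (?\<phi> z) (?\<phi> w) = dist z w" for z w
  proof -
    obtain x y x' y' where zw: "z = (x, y)" "w = (x', y')" by fastforce
    have "(p * (x - x') - q * (y - y'))\<^sup>2 + (q * (x - x') + p * (y - y'))\<^sup>2
      = (p\<^sup>2 + q\<^sup>2) * ((x - x')\<^sup>2 + (y - y')\<^sup>2)"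
      by (simp add: power2_eq_square algebra_simps)
    then have "(p * x - q * y + u - (p * x' - q * y' + u))\<^sup>2 + (q * x + p * y + v - (q * x' + p * y' + v))\<^sup>2
      = (x - x')\<^sup>2 + (y - y')\<^sup>2"
      unfolding assms by (simp add: algebra_simps)
    then show ?thesis
      by (simp add: zw dist_Pair_Pair dist_real_def)
  qed
  have "inj ?\<phi>"
  proof (rule injI)
    fix z w
    assume eq: "?\<phi> z = ?\<phi> w"
    have "dist z w = dist (?\<phi> z) (?\<phi> w)"
      by (rule dist[symmetric])
    also have "\<dots> = 0"
      unfolding eq by (rule dist_self)
    finally show "z = w" by simp
  qed
  moreover have "surj ?\<phi>"
  proof (rule surjI)
    fix z :: "real \<times> real"
    obtain X Y where z: "z = (X, Y)" by fastforce
    have "p * (p * (X - u) + q * (Y - v)) - q * (- q * (X - u) + p * (Y - v)) = (p\<^sup>2 + q\<^sup>2) * (X - u)"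
      "q * (p * (X - u) + q * (Y - v)) + p * (- q * (X - u) + p * (Y - v)) = (p\<^sup>2 + q\<^sup>2) * (Y - v)"
      by (simp_all add: power2_eq_square algebra_simps)
    then show "?\<phi> ((\<lambda>(X, Y). (p * (X - u) + q * (Y - v), - q * (X - u) + p * (Y - v))) z) = z"
      unfolding assms by (simp add: z)
  qed
  ultimately show ?thesis
    using dist unfolding plane_isometry_def bij_def by blast
qed

text \<open>Both graphs are lines, so a rotation by the angle between them and a translation
  suffice.\<close>

lemma vertically_rigid_affine: "vertically_rigid (\<lambda>x. a + b * x)"
  unfolding vertically_rigid_def
proof (intro allI impI)
  fix c :: real
  assume "c > 0"
  define N where "N = sqrt ((1 + b\<^sup>2) * (1 + (c * b)\<^sup>2))"
  have N2: "N\<^sup>2 = (1 + b\<^sup>2) * (1 + (c * b)\<^sup>2)" and "N > 0"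
    by (simp_all add: N_def add_pos_nonneg)
  \<comment> \<open>Cosine and sine of the angle from \<open>(1, c * b)\<close> to
    \<open>(1, b)\<close>: their dot and cross products, divided by the product \<open>N\<close> of
    their lengths.\<close>
  define p q where "p = (1 + c * b\<^sup>2) / N" and "q = (b - c * b) / N"
  define l where "l = (1 + (c * b)\<^sup>2) / N"
  have "(1 + c * b\<^sup>2)\<^sup>2 + (b - c * b)\<^sup>2 = N\<^sup>2"
    unfolding N2 by (simp add: power2_eq_square algebra_simps)
  then have "p\<^sup>2 + q\<^sup>2 = 1"
    using \<open>N > 0\<close> by (simp add: p_def q_def power_divide flip: add_divide_distrib)
  have l: "p - q * (c * b) = l" "q + p * (c * b) = b * l" "l \<noteq> 0"
  proof -
    have "1 + c * b\<^sup>2 - (b - c * b) * (c * b) = 1 + (c * b)\<^sup>2"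
      "b - c * b + (1 + c * b\<^sup>2) * (c * b) = b * (1 + (c * b)\<^sup>2)"
      by (simp_all add: power2_eq_square algebra_simps)
    then show "p - q * (c * b) = l" "q + p * (c * b) = b * l"
      by (simp_all add: p_def q_def l_def flip: diff_divide_distrib add_divide_distrib)
    show "l \<noteq> 0"
      using \<open>N > 0\<close> by (simp add: l_def add_nonneg_eq_0_iff)
  qed
  \<comment> \<open>The translation is chosen to send \<open>(0, c * a)\<close> to
    \<open>(0, a)\<close>; abscissas along the line are then multiplied by \<open>l\<close>, and
    \<open>l \<noteq> 0\<close> makes the map onto the target line.\<close>
  let ?\<phi> = "\<lambda>(x, y). (p * x - q * y + q * c * a, q * x + p * y + (a - p * c * a))"
  have image: "?\<phi> (x, c * (a + b * x)) = (l * x, a + b * (l * x))" for x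
  proof -
    have "p * x - q * (c * (a + b * x)) + q * c * a = (p - q * (c * b)) * x"
      "q * x + p * (c * (a + b * x)) + (a - p * c * a) = a + (q + p * (c * b)) * x"
      by (simp_all add: algebra_simps)
    then show ?thesis
      unfolding l by (simp add: mult.assoc)
  qed
  have "?\<phi> ` fun_graph (\<lambda>x. c * (a + b * x)) = fun_graph (\<lambda>x. a + b * x)"
  proof (intro equalityI subsetI)
    fix z
    assume "z \<in> ?\<phi> ` fun_graph (\<lambda>x. c * (a + b * x))"
    then obtain x where "z = ?\<phi> (x, c * (a + b * x))"
      unfolding fun_graph_def by blast
    then show "z \<in> fun_graph (\<lambda>x. a + b * x)"
      unfolding image fun_graph_def by blast
  next
    fix z
    assume "z \<in> fun_graph (\<lambda>x. a + b * x)"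
    then obtain X where "z = (X, a + b * X)"
      unfolding fun_graph_def by blast
    then have "z = ?\<phi> (X / l, c * (a + b * (X / l)))"
      unfolding image using l(3) by simp
    then show "z \<in> ?\<phi> ` fun_graph (\<lambda>x. c * (a + b * x))"
      unfolding fun_graph_def by blast
  qed
  then show "isometric_sets (fun_graph (\<lambda>x. c * (a + b * x))) (fun_graph (\<lambda>x. a + b * x))"
    unfolding isometric_sets_def
    using plane_isometry_rigid_motion[OF \<open>p\<^sup>2 + q\<^sup>2 = 1\<close>] by blast
qed

text \<open>Multiplying \<open>exp (k * x)\<close> by \<open>c\<close> shifts it horizontally by
  \<open>ln c / k\<close>, and a vertical shift corrects the constant \<open>a\<close>. For
  \<open>k = 0\<close> the function is constant, hence affine.\<close>

lemma vertically_rigid_exp: "vertically_rigid (\<lambda>x. a + b * exp (k * x))"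
proof (cases "k = 0")
  case True
  then show ?thesis
    using vertically_rigid_affine[of "a + b" 0] by simp
next
  case False
  show ?thesis
    unfolding vertically_rigid_def
  proof (intro allI impI)
    fix c :: real
    assume "c > 0"
    let ?f = "\<lambda>x. a + b * exp (k * x)"
    let ?u = "ln c / k" and ?v = "a - c * a"
    \<comment> \<open>A translation, written as a rigid motion with \<open>p = 1\<close> and
      \<open>q = 0\<close> to match \<open>plane_isometry_rigid_motion\<close>.\<close>
    let ?\<phi> = "\<lambda>(x, y). (1 * x - 0 * y + ?u, 0 * x + 1 * y + ?v)"
    have shift: "?f (x + ?u) = c * ?f x + ?v" for x
      using False \<open>c > 0\<close> by (simp add: distrib_left exp_add)
    have image: "?\<phi> (x, c * ?f x) = (x + ?u, ?f (x + ?u))" for x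
      unfolding shift by simp
    have "?\<phi> ` fun_graph (\<lambda>x. c * ?f x) = fun_graph ?f"
    proof (intro equalityI subsetI)
      fix z
      assume "z \<in> ?\<phi> ` fun_graph (\<lambda>x. c * ?f x)"
      then obtain x where "z = ?\<phi> (x, c * ?f x)"
        unfolding fun_graph_def by blast
      then show "z \<in> fun_graph ?f"
        unfolding image fun_graph_def by blast
    next
      fix z
      assume "z \<in> fun_graph ?f"
      then obtain X where "z = (X, ?f X)"
        unfolding fun_graph_def by blast
      then have "z = ?\<phi> (X - ?u, c * ?f (X - ?u))"
        unfolding image by simp
      then show "z \<in> ?\<phi> ` fun_graph (\<lambda>x. c * ?f x)"
        unfolding fun_graph_def by blast
    qed
    moreover have "plane_isometry ?\<phi>"
      by (rule plane_isometry_rigid_motion) simp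
    ultimately show "isometric_sets (fun_graph (\<lambda>x. c * ?f x)) (fun_graph ?f)"
      unfolding isometric_sets_def by blast
  qed
qed

theorem theorem2p1:
  fixes f :: "real \<Rightarrow> real"
  assumes "continuous_on UNIV f"
  shows "vertically_rigid f \<longleftrightarrow>
    (\<exists>a b k :: real. (\<forall>x. f x = a + b * x) \<or> (\<forall>x. f x = a + b * exp (k * x)))"
proof
  assume "vertically_rigid f"
  then show "\<exists>a b k. (\<forall>x. f x = a + b * x) \<or> (\<forall>x. f x = a + b * exp (k * x))"
    by (rule vertically_rigid_imp[OF assms])
next
  assume "\<exists>a b k. (\<forall>x. f x = a + b * x) \<or> (\<forall>x. f x = a + b * exp (k * x))"
  then have "\<exists>a b k. f = (\<lambda>x. a + b * x) \<or> f = (\<lambda>x. a + b * exp (k * x))"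
    unfolding fun_eq_iff .
  then show "vertically_rigid f"
    using vertically_rigid_affine vertically_rigid_exp by blast
qed

end
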